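(* There exists $\underline{M}\in\mathfrak{M}_{\infty}\setminus\{RL^{\infty}\}$ such that for some $(\alpha,\beta)\in U$ we have $\Theta_{\underline{M}}(\alpha,\beta)=0$ but $K(\alpha,\beta)\ne\underline{M}$; moreover, for such $(\alpha,\beta)$ one has $K(\alpha,\beta)\prec\underline{M}$.
   Context: Let $U=\{(\alpha,\beta): 1/2<\beta\le 1,\ 1-\beta<\alpha<\beta\}$. For $(\alpha,\beta)\in U$ the skew tent map $T_{\alpha,\beta}:[0,1]\to[0,1]$ is $T_{\alpha,\beta}(x)=\frac{\beta}{\alpha}x$ for $0\le x\le\alpha$ and $T_{\alpha,\beta}(x)=\frac{\beta}{1-\alpha}(1-x)$ for $\alpha<x\le1$. The extended itinerary of $x\in[0,1]$ is the sequence indexed by $n\ge 0$ whose $n$-th entry is $L$, $C$ or $R$ according to whether $T_{\alpha,\beta}^n(x)<\alpha$, $=\alpha$ or $>\alpha$. The itinerary $\underline{I}_{\alpha,\beta}(x)$ is the extended itinerary if it contains no $C$; otherwise it is the finite string obtained by stopping at (and including) the first $C$. The kneading sequence is $K(\alpha,\beta)=\underline{I}_{\alpha,\beta}(\beta)$. $\mathfrak{M}$ is the set of all kneading sequences $K(1/2,\beta)$, $\beta\in(1/2,1]$. $\mathfrak{M}_\infty$ is the set of those elements of $\mathfrak{M}$ which do not contain $C$ (the infinite ones). Ordering: $L\prec C\prec R$; for two different itineraries $\underline{A},\underline{B}$ let $n$ be the first index with $A_n\ne B_n$; if the number of $R$'s in $A_0\dots A_{n-1}$ is even, then $\underline{A}\prec\underline{B}$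 iff $A_n\prec B_n$; if it is odd, then $\underline{A}\prec\underline{B}$ iff $B_n\prec A_n$. For $\underline{M}\in\mathfrak{M}_\infty\setminus\{RL^{\infty}\}$ the sequence $\underline{M}$ starts with $R$ and contains infinitely many $R$'s, so it can be written uniquely as $\underline{M}=R\,L^{m_1}R\,L^{m_2}R\,L^{m_3}R\dots$ with integers $m_i\ge0$; put $\overline{m}_k=m_1+\dots+m_k$ and $$\Theta_{\underline{M}}(\alpha,\beta)=1-\beta+\sum_{k=1}^{\infty}(-1)^{k}\left(\frac{1-\alpha}{\beta}\right)^{k}\left(\frac{\alpha}{\beta}\right)^{\overline{m}_k}\qquad((\alpha,\beta)\in U).$$ *)

theory Defs imports Complex_Main begin

definition U :: "(real \<times> real) set" where
  "U = {(\<alpha>, \<beta>). 1/2 < \<beta> \<and> \<beta> \<le> 1 \<and> 1 - \<beta> < \<alpha> \<and> \<alpha> < \<beta>}"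

text \<open>Skew tent map; only its restriction to the unit interval, for parameters in \<open>U\<close>, matters.\<close>

definition tent :: "real \<Rightarrow> real \<Rightarrow> real \<Rightarrow> real" where
  "tent \<alpha> \<beta> x = (if x \<le> \<alpha> then \<beta> / \<alpha> * x else \<beta> / (1 - \<alpha>) * (1 - x))"

datatype sym = L | C | R

definition sym_less :: "sym \<Rightarrow> sym \<Rightarrow> bool" where
  "sym_less a b \<longleftrightarrow> (a, b) \<in> {(L, C), (L, R), (C, R)}"

definition ext_itinerary :: "real \<Rightarrow> real \<Rightarrow> real \<Rightarrow> nat \<Rightarrow> sym" where
  "ext_itinerary \<alpha> \<beta> x n =
     (let y = (tent \<alpha> \<beta> ^^ n) x in if y < \<alpha> then L else if y = \<alpha> then C else R)"

text \<open>A finite or infinite string is a function into \<open>sym option\<close>: the \<open>n\<close>-th entry is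
  \<open>Some s\<close>, or \<open>None\<close> if the string has already ended before position \<open>n\<close>.\<close>

type_synonym itin = "nat \<Rightarrow> sym option"

definition itinerary :: "real \<Rightarrow> real \<Rightarrow> real \<Rightarrow> itin" where
  "itinerary \<alpha> \<beta> x n =
     (if \<exists>k<n. ext_itinerary \<alpha> \<beta> x k = C then None else Some (ext_itinerary \<alpha> \<beta> x n))"

definition kneading :: "real \<Rightarrow> real \<Rightarrow> itin" where
  "kneading \<alpha> \<beta> = itinerary \<alpha> \<beta> \<beta>"

definition kneading_seqs :: "itin set" where
  "kneading_seqs = {kneading (1/2) \<beta> |\<beta>. 1/2 < \<beta> \<and> \<beta> \<le> 1}"

definition kneading_seqs_inf :: "itin set" where
  "kneading_seqs_inf = {M \<in> kneading_seqs. \<forall>n. M n \<noteq> Some C}"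

definition RL_inf :: itin where
  "RL_inf n = Some (if n = 0 then R else L)"

text \<open>Two different itineraries first differ at an index where both are defined,
  since a finite itinerary ends exactly at its first \<open>C\<close>.\<close>

definition itin_less :: "itin \<Rightarrow> itin \<Rightarrow> bool" (infix "\<prec>" 50) where
  "A \<prec> B \<longleftrightarrow> (\<exists>n a b. (\<forall>i<n. A i = B i) \<and> A n = Some a \<and> B n = Some b \<and> a \<noteq> b \<and>
     (if even (card {i. i < n \<and> A i = Some R}) then sym_less a b else sym_less b a))"

text \<open>The sequence \<open>m\<^sub>1, m\<^sub>2, \<dots>\<close> is indexed from \<open>0\<close> here, i.e. \<open>m i\<close> stands for \<open>m\<^sub>i\<^sub>+\<^sub>1\<close>,
  so that \<open>\<Sum>i<k. m i\<close> is \<open>m\<^sub>1 + \<dots> + m\<^sub>k\<close>.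
  In \<open>R L^m\<^sub>1 R L^m\<^sub>2 R \<dots>\<close> the \<open>k\<close>-th \<open>R\<close> (counted from \<open>0\<close>) is preceded by \<open>k\<close> letters \<open>R\<close>
  and \<open>m\<^sub>1 + \<dots> + m\<^sub>k\<close> letters \<open>L\<close>.\<close>

definition R_blocks :: "(nat \<Rightarrow> nat) \<Rightarrow> itin" where
  "R_blocks m n = Some (if \<exists>k. n = k + (\<Sum>i<k. m i) then R else L)"

text \<open>Meaningful for strings over \<open>{L, R}\<close> starting with \<open>R\<close> and having infinitely many \<open>R\<close>'s.\<close>

definition block_lengths :: "itin \<Rightarrow> nat \<Rightarrow> nat" where
  "block_lengths M = (THE m. M = R_blocks m)"

definition m_bar :: "itin \<Rightarrow> nat \<Rightarrow> nat" where
  "m_bar M k = (\<Sum>i<k. block_lengths M i)"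

text \<open>The sum over \<open>k \<ge> 1\<close> is shifted to start at \<open>0\<close>.\<close>

definition Theta :: "itin \<Rightarrow> real \<Rightarrow> real \<Rightarrow> real" where
  "Theta M \<alpha> \<beta> = 1 - \<beta> +
     (\<Sum>k. (-1) ^ Suc k * ((1 - \<alpha>) / \<beta>) ^ Suc k * (\<alpha> / \<beta>) ^ m_bar M (Suc k))"

end

theory Submission imports Defs begin

text \<open>Put \<open>a = (1 - \<alpha>)/\<beta>\<close> and \<open>b = \<alpha>/\<beta>\<close>, the reciprocals of the slopes of the tent map. The
  inverses of its two affine pieces are \<open>y \<mapsto> b y\<close> (letter \<open>L\<close>) and \<open>y \<mapsto> 1 - a y\<close> (letter
  \<open>R\<close>). Composing them along all of \<open>M\<close> yields a point \<open>y\<^sub>0\<close>, and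
  \<open>\<Theta>\<^sub>M(\<alpha>, \<beta>) = y\<^sub>0 - \<beta>\<close>; the shifts of \<open>M\<close> yield in the same way a sequence \<open>y\<^sub>n\<close>. Thus
  \<open>\<Theta>\<^sub>M = 0\<close> says that \<open>\<beta>\<close> has a formal orbit \<open>y\<^sub>0 = \<beta>, y\<^sub>1, y\<^sub>2, \<dots>\<close> obtained by
  obeying the letters of \<open>M\<close>, and this is the orbit of \<open>\<beta>\<close> under the tent map precisely as
  long as each \<open>y\<^sub>n\<close> lies on the side of \<open>\<alpha>\<close> prescribed by the \<open>n\<close>-th letter. A zero of
  \<open>\<Theta>\<^sub>M\<close> with \<open>K(\<alpha>, \<beta>) \<noteq> M\<close> is one where some \<open>y\<^sub>n\<close> is on the wrong side.

  The witness is \<open>M = RLLL(RLR)\<^sup>\<infinity>\<close>. Its formal orbit is eventually periodic with values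
  \<open>y\<^sub>0 = 1 - a b\<^sup>3 z\<close>, \<open>y\<^sub>n = b\<^sup>4\<^sup>-\<^sup>n z\<close> for \<open>n = 1, 2, 3\<close>, and then \<open>z\<close>, \<open>b (1 - a z)\<close>,
  \<open>1 - a z\<close> repeated, where \<open>z\<close> is the fixed point of the inverse branch along \<open>RLR\<close>; so
  everything is an explicit rational function of \<open>\<alpha>\<close> and \<open>\<beta>\<close>.

  On the line \<open>\<alpha> = 1/2\<close>, where \<open>a = b = t\<close> with \<open>t = 1/(2 \<beta>)\<close>, the equation
  \<open>\<Theta>\<^sub>M = 0\<close> is a polynomial equation in \<open>t\<close> with a root in \<open>(1/2, 3/5]\<close> and another in
  \<open>[7/10, 1)\<close>. At the first, all \<open>y\<^sub>n\<close> are on the right side, so \<open>M\<close> is a kneading sequence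
  (lemma \<open>witness_in_kneading_seqs_inf\<close>). At the second, \<open>y\<^sub>3 \<ge> 1/2\<close>,
  although the letter with index 3 is \<open>L\<close> (lemma \<open>Theta_witness_spurious_zero\<close>).

  At any zero in \<open>U\<close> the inequality \<open>y\<^sub>1 = b\<^sup>3 z < z = y\<^sub>7\<close> pushes through the branches:
  it gives \<open>y\<^sub>6 < \<beta>\<close>, hence \<open>y\<^sub>5 < \<alpha>\<close>, hence \<open>y\<^sub>4 > \<alpha>\<close>. So the first letter obeyed
  wrongly can only be an \<open>L\<close> with index 1, 2 or 3, preceded by one \<open>R\<close>, or the \<open>R\<close> with
  index 6, preceded by two. In both cases the parity rule makes \<open>K(\<alpha>, \<beta>)\<close> the smaller
  sequence (lemma \<open>kneading_less_witness\<close>).\<close>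

section \<open>Backward orbits along a prescribed letter sequence\<close>

text \<open>The relation is stated with the inverse branches, without asking that \<open>y n\<close> lie on the side
  of \<open>\<alpha>\<close> named by \<open>w n\<close>: such a sequence exists for every letter sequence, whether or not
  the tent map realises it.\<close>

definition backward_orbit :: "real \<Rightarrow> real \<Rightarrow> (nat \<Rightarrow> sym) \<Rightarrow> (nat \<Rightarrow> real) \<Rightarrow> bool" where
  "backward_orbit \<alpha> \<beta> w y \<longleftrightarrow>
     (\<forall>n. y n = (if w n = L then \<alpha> / \<beta> * y (Suc n) else 1 - (1 - \<alpha>) / \<beta> * y (Suc n)))"

lemma U_D:
  assumes "(\<alpha>, \<beta>) \<in> U"
  shows "0 < \<alpha>" "\<alpha> < 1" "0 < \<beta>" "\<alpha> < \<beta>" "\<beta> \<le> 1" "1 - \<alpha> < \<beta>"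
  using assms by (auto simp: U_def)

text \<open>The tent map undoes an inverse branch as soon as the point lies on the matching side of
  \<open>\<alpha>\<close>, and the agreement of the letters below index \<open>n\<close> says just that.\<close>

lemma tent_orbit_eq_backward_orbit:
  assumes "(\<alpha>, \<beta>) \<in> U" and y: "backward_orbit \<alpha> \<beta> w y" "y 0 = \<beta>" and w: "\<And>i. w i \<noteq> C"
    and "\<And>i. i < n \<Longrightarrow> ext_itinerary \<alpha> \<beta> \<beta> i = w i"
  shows "(tent \<alpha> \<beta> ^^ n) \<beta> = y n"
  using assms(5)
proof (induction n)
  case (Suc n)
  have IH: "(tent \<alpha> \<beta> ^^ n) \<beta> = y n" and "ext_itinerary \<alpha> \<beta> \<beta> n = w n"
    using Suc by auto
  hence side: "w n = (if y n < \<alpha> then L else if y n = \<alpha> then C else R)"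
    by (simp add: ext_itinerary_def Let_def)
  have "y n = (if w n = L then \<alpha> / \<beta> * y (Suc n) else 1 - (1 - \<alpha>) / \<beta> * y (Suc n))"
    using y(1) by (simp add: backward_orbit_def)
  moreover have "w n = L \<and> y n < \<alpha> \<or> w n = R \<and> \<alpha> < y n"
    using side w[of n] by (auto split: if_splits)
  ultimately have "tent \<alpha> \<beta> (y n) = y (Suc n)"
    using U_D[OF assms(1)] by (auto simp: tent_def)
  then show ?case using IH by simp
qed (use y in simp)

text \<open>At the first index where the kneading sequence departs from \<open>w\<close>, the actual orbit still
  coincides with the formal one. This turns the comparison of \<open>K(\<alpha>, \<beta>)\<close> with \<open>w\<close> into
  inequalities between \<open>\<alpha>\<close> and the explicitly known numbers \<open>y n\<close>.\<close>

lemma first_difference: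
  assumes "(\<alpha>, \<beta>) \<in> U" and "backward_orbit \<alpha> \<beta> w y" "y 0 = \<beta>" and w: "\<And>i. w i \<noteq> C"
    and "kneading \<alpha> \<beta> \<noteq> (\<lambda>n. Some (w n))"
  obtains n c where "\<And>i. i < n \<Longrightarrow> kneading \<alpha> \<beta> i = Some (w i)" and "kneading \<alpha> \<beta> n = Some c"
    and "w n = L \<and> \<alpha> \<le> y n \<and> c \<in> {C, R} \<or> w n = R \<and> y n \<le> \<alpha> \<and> c \<in> {L, C}"
    and "\<And>i. i < n \<Longrightarrow> (if w i = L then y i < \<alpha> else \<alpha> < y i)"
proof -
  define n where "n = (LEAST n. kneading \<alpha> \<beta> n \<noteq> Some (w n))"
  have ne: "kneading \<alpha> \<beta> n \<noteq> Some (w n)"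
    unfolding n_def using assms(5) by (metis (mono_tags, lifting) LeastI ext)
  have eq: "kneading \<alpha> \<beta> i = Some (w i)" if "i < n" for i
    using that not_less_Least unfolding n_def by blast
  hence ext: "ext_itinerary \<alpha> \<beta> \<beta> i = w i" if "i < n" for i
    using that by (fastforce simp: kneading_def itinerary_def split: if_splits)
  have orbit: "(tent \<alpha> \<beta> ^^ k) \<beta> = y k" if "k \<le> n" for k
    using tent_orbit_eq_backward_orbit[OF assms(1-4), of k] ext that by auto
  have c: "kneading \<alpha> \<beta> n = Some (ext_itinerary \<alpha> \<beta> \<beta> n)"
    using ext w by (auto simp: kneading_def itinerary_def)
  have letter: "ext_itinerary \<alpha> \<beta> \<beta> k = (if y k < \<alpha> then L else if y k = \<alpha> then C else R)"
    if "k \<le> n" for k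
    using orbit[OF that] by (simp add: ext_itinerary_def Let_def)
  show thesis
  proof (rule that[OF eq c])
    show "w n = L \<and> \<alpha> \<le> y n \<and> ext_itinerary \<alpha> \<beta> \<beta> n \<in> {C, R} \<or>
          w n = R \<and> y n \<le> \<alpha> \<and> ext_itinerary \<alpha> \<beta> \<beta> n \<in> {L, C}"
      using ne c w[of n] letter[of n] by (cases "w n") (auto split: if_splits)
    show "if w i = L then y i < \<alpha> else \<alpha> < y i" if "i < n" for i
      using letter[of i] ext[OF that] that w[of i] by (auto split: if_splits)
  qed
qed

lemma kneading_eqI:
  assumes "(\<alpha>, \<beta>) \<in> U" and "backward_orbit \<alpha> \<beta> w y" "y 0 = \<beta>" and "\<And>i. w i \<noteq> C"
    and "\<And>n. if w n = L then y n < \<alpha> else \<alpha> < y n"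
  shows "kneading \<alpha> \<beta> = (\<lambda>n. Some (w n))"
proof (rule ccontr)
  assume "kneading \<alpha> \<beta> \<noteq> (\<lambda>n. Some (w n))"
  from first_difference[OF assms(1-4) this] obtain n where
    "w n = L \<and> \<alpha> \<le> y n \<or> w n = R \<and> y n \<le> \<alpha>"
    by metis
  thus False using assms(5)[of n] by auto
qed

lemma kneading_eqD:
  assumes "(\<alpha>, \<beta>) \<in> U" and "backward_orbit \<alpha> \<beta> w y" "y 0 = \<beta>" and "\<And>i. w i \<noteq> C"
    and "kneading \<alpha> \<beta> = (\<lambda>n. Some (w n))" and "w n = L"
  shows "y n < \<alpha>"
proof -
  have ext: "ext_itinerary \<alpha> \<beta> \<beta> i = w i" for i
    using fun_cong[OF assms(5), of i] by (simp add: kneading_def itinerary_def split: if_splits)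
  from tent_orbit_eq_backward_orbit[OF assms(1-4) ext]
  have "(tent \<alpha> \<beta> ^^ n) \<beta> = y n" .
  thus ?thesis using ext[of n] assms(6)
    by (simp add: ext_itinerary_def Let_def split: if_splits)
qed

section \<open>Block lengths\<close>

text \<open>The block lengths are the gaps between consecutive positions of \<open>R\<close>, and a strictly
  increasing enumeration of the set of these positions is determined by that set.\<close>

lemma block_lengths_R_blocks: "block_lengths (R_blocks m) = m"
  unfolding block_lengths_def
proof (rule the_equality)
  fix m' assume eq: "R_blocks m = R_blocks m'"
  define p where "p m k = k + (\<Sum>i<k. m i)" for m :: "nat \<Rightarrow> nat" and k
  have mono: "strict_mono (p m)" for m
    by (simp add: strict_mono_Suc_iff p_def)
  have "n \<in> range (p m) \<longleftrightarrow> n \<in> range (p m')" for n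
  proof -
    have "n \<in> range (p f) \<longleftrightarrow> R_blocks f n = Some R" for f
      by (simp add: R_blocks_def p_def image_iff)
    thus ?thesis by (simp only: eq)
  qed
  hence ranges: "range (p m) = range (p m')" by blast
  have p_eq: "p m = p m'"
  proof
    fix k show "p m k = p m' k"
    proof (induction k rule: less_induct)
      case (less k)
      have le: "p f k \<le> p g k" if "range (p f) = range (p g)" "\<And>j. j < k \<Longrightarrow> p f j = p g j" for f g
      proof -
        have "p g k \<in> range (p f)" unfolding that(1) by (rule rangeI)
        then obtain j where j: "p g k = p f j" by (rule imageE)
        have "k \<le> j"
        proof (rule ccontr)
          assume "\<not> k \<le> j"
          hence "p g j = p g k" "j < k" using that(2) j by auto
          thus False using strict_mono_less[OF mono[of g], of j k] by linarith
        qed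
        thus ?thesis unfolding j by (simp only: strict_mono_less_eq[OF mono])
      qed
      show ?case
      proof (rule order_antisym)
        show "p m k \<le> p m' k" by (rule le[OF ranges less])
        show "p m' k \<le> p m k" by (rule le[OF ranges[symmetric] less[symmetric]])
      qed
    qed
  qed
  have "m' k = m k" for k
    using fun_cong[OF p_eq, of k] fun_cong[OF p_eq, of "Suc k"] by (simp add: p_def)
  thus "m' = m" by blast
qed simp

section \<open>The sequence \<open>RLLL(RLR)\<^sup>\<infinity>\<close>\<close>

text \<open>The periodic part starts at index 4, which is congruent to 1 modulo 3, so its only \<open>L\<close>
  occupies the indices congruent to 2.\<close>

definition witness_letter :: "nat \<Rightarrow> sym" where
  "witness_letter n = (if n = 0 then R else if n < 4 then L else if n mod 3 = 2 then L else R)"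

definition witness :: itin where
  "witness n = Some (witness_letter n)"

definition witness_blocks :: "nat \<Rightarrow> nat" where
  "witness_blocks i = (if i = 0 then 3 else if odd i then 1 else 0)"

lemma sum_witness_blocks: "(\<Sum>i<Suc k. witness_blocks i) = 3 + Suc k div 2"
  by (induction k) (auto simp: witness_blocks_def)

lemma witness_eq_R_blocks: "witness = R_blocks witness_blocks"
proof
  fix n
  have "(\<exists>k. n = k + (\<Sum>i<k. witness_blocks i)) \<longleftrightarrow> n = 0 \<or> (\<exists>k. n = Suc k + (3 + Suc k div 2))"
    by (metis add_0 lessThan_0 not0_implies_Suc sum.empty sum_witness_blocks)
  also have "(\<exists>k. n = Suc k + (3 + Suc k div 2)) \<longleftrightarrow> n \<ge> 4 \<and> n mod 3 \<noteq> 2"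
    by presburger
  finally show "witness n = R_blocks witness_blocks n"
    by (auto simp: witness_def R_blocks_def witness_letter_def)
qed

lemma m_bar_witness: "m_bar witness (Suc k) = 3 + Suc k div 2"
  by (simp only: m_bar_def witness_eq_R_blocks block_lengths_R_blocks sum_witness_blocks)

text \<open>The fixed point of \<open>y \<mapsto> 1 - a b (1 - a y)\<close>, the inverse branch along \<open>RLR\<close>.\<close>

definition RLR_point :: "real \<Rightarrow> real \<Rightarrow> real" where
  "RLR_point a b = (1 - a * b) / (1 - a\<^sup>2 * b)"

text \<open>The formal orbit of the witness, with \<open>a\<close> and \<open>b\<close> for the reciprocals of the slopes.\<close>

definition witness_orbit :: "real \<Rightarrow> real \<Rightarrow> nat \<Rightarrow> real" where
  "witness_orbit a b n =
     (let z = RLR_point a b in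
      if n = 0 then 1 - a * b ^ 3 * z else if n < 4 then b ^ (4 - n) * z
      else if n mod 3 = 1 then z else if n mod 3 = 2 then b * (1 - a * z) else 1 - a * z)"

lemma RLR_point_fixed:
  assumes "a\<^sup>2 * b \<noteq> 1"
  shows "1 - a * (b * (1 - a * RLR_point a b)) = RLR_point a b"
  using assms by (simp add: RLR_point_def field_simps power2_eq_square)

lemma backward_orbit_witness:
  assumes "((1 - \<alpha>) / \<beta>)\<^sup>2 * (\<alpha> / \<beta>) \<noteq> 1"
  shows "backward_orbit \<alpha> \<beta> witness_letter (witness_orbit ((1 - \<alpha>) / \<beta>) (\<alpha> / \<beta>))"
  unfolding backward_orbit_def
proof
  fix n :: nat
  define a b where "a = (1 - \<alpha>) / \<beta>" and "b = \<alpha> / \<beta>"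
  note fixed = RLR_point_fixed[OF assms, folded a_def b_def]
  consider "n = 0" | "n = 1" | "n = 2" | "n = 3" | "n \<ge> 4" "n mod 3 = 0" |
    "n \<ge> 4" "n mod 3 = 1" | "n \<ge> 4" "n mod 3 = 2"
    by linarith
  hence "witness_orbit a b n = (if witness_letter n = L then b * witness_orbit a b (Suc n)
      else 1 - a * witness_orbit a b (Suc n))"
  proof cases
    case 1 thus ?thesis by (simp add: witness_orbit_def witness_letter_def Let_def power_numeral_reduce)
  next
    case 2 thus ?thesis by (simp add: witness_orbit_def witness_letter_def Let_def power_numeral_reduce)
  next
    case 3 thus ?thesis by (simp add: witness_orbit_def witness_letter_def Let_def power_numeral_reduce)
  next
    case 4 thus ?thesis by (simp add: witness_orbit_def witness_letter_def Let_def)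
  next
    case 5 thus ?thesis by (simp add: witness_orbit_def witness_letter_def Let_def mod_Suc)
  next
    case 6 thus ?thesis using fixed by (simp add: witness_orbit_def witness_letter_def Let_def mod_Suc)
  next
    case 7 thus ?thesis by (simp add: witness_orbit_def witness_letter_def Let_def mod_Suc)
  qed
  thus "witness_orbit ((1 - \<alpha>) / \<beta>) (\<alpha> / \<beta>) n = (if witness_letter n = L
      then \<alpha> / \<beta> * witness_orbit ((1 - \<alpha>) / \<beta>) (\<alpha> / \<beta>) (Suc n)
      else 1 - (1 - \<alpha>) / \<beta> * witness_orbit ((1 - \<alpha>) / \<beta>) (\<alpha> / \<beta>) (Suc n))"
    by (simp add: a_def b_def)
qed

lemma witness_letter_neq_C: "witness_letter n \<noteq> C"
  by (simp add: witness_letter_def)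

lemma inverse_slopes:
  assumes "(\<alpha>, \<beta>) \<in> U"
  defines "a \<equiv> (1 - \<alpha>) / \<beta>" and "b \<equiv> \<alpha> / \<beta>"
  shows "0 < a" "a < 1" "0 < b" "b < 1" "a * b < 1" "a\<^sup>2 * b < 1" "0 < RLR_point a b"
proof -
  show ab: "0 < a" "a < 1" "0 < b" "b < 1"
    using U_D[OF assms(1)] by (auto simp: a_def b_def)
  show 1: "a * b < 1"
    using ab by (metis less_eq_real_def mult_le_one mult.commute mult_less_cancel_left2 not_le order_trans)
  have "a\<^sup>2 * b = a * (a * b)" by (simp add: power2_eq_square)
  also have "\<dots> < 1 * 1" using ab 1 by (intro mult_strict_mono) auto
  finally show "a\<^sup>2 * b < 1" by simp
  thus "0 < RLR_point a b" using 1 by (simp add: RLR_point_def)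
qed

text \<open>Advancing the index by 2 passes one more period \<open>RLR\<close> and multiplies the term of the series
  by \<open>a\<^sup>2 b\<close>, so that the sum solves a linear equation.\<close>

lemma Theta_witness:
  assumes "(\<alpha>, \<beta>) \<in> U"
  shows "Theta witness \<alpha> \<beta> = witness_orbit ((1 - \<alpha>) / \<beta>) (\<alpha> / \<beta>) 0 - \<beta>"
proof -
  define a b where "a = (1 - \<alpha>) / \<beta>" and "b = \<alpha> / \<beta>"
  note ab = inverse_slopes[OF assms, folded a_def b_def]
  define g where "g k = (-1) ^ Suc k * a ^ Suc k * b ^ (3 + Suc k div 2)" for k
  have "summable g"
  proof (rule summable_comparison_test')
    show "summable (\<lambda>k. a ^ k)" using ab by (simp add: summable_geometric)
    fix k
    have "norm (g k) = a ^ Suc k * b ^ (3 + Suc k div 2)"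
      using ab by (simp add: g_def abs_mult power_abs)
    also have "\<dots> \<le> a ^ k * 1"
      using ab by (intro mult_mono power_decreasing power_le_one) auto
    finally show "norm (g k) \<le> a ^ k" by simp
  qed
  hence "suminf g = (\<Sum>k. g (k + 2)) + (\<Sum>k<2. g k)"
    by (rule suminf_split_initial_segment)
  also have "(\<lambda>k. g (k + 2)) = (\<lambda>k. a\<^sup>2 * b * g k)"
  proof
    fix k
    have "3 + Suc (k + 2) div 2 = Suc (3 + Suc k div 2)" by simp
    thus "g (k + 2) = a\<^sup>2 * b * g k"
      unfolding g_def by (simp only: power_Suc power_add power2_eq_square) (simp add: algebra_simps)
  qed
  also have "(\<Sum>k. a\<^sup>2 * b * g k) = a\<^sup>2 * b * suminf g"
    by (rule suminf_mult[OF \<open>summable g\<close>])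
  also have "(\<Sum>k<2. g k) = - (a * b ^ 3 * (1 - a * b))"
    by (simp add: g_def numeral_2_eq_2 algebra_simps power_numeral_reduce)
  finally have "suminf g * (1 - a\<^sup>2 * b) = - (a * b ^ 3 * (1 - a * b))"
    by (simp add: algebra_simps)
  hence "suminf g = - (a * b ^ 3 * RLR_point a b)"
    using ab(6) by (simp add: RLR_point_def field_simps)
  moreover have "Theta witness \<alpha> \<beta> = 1 - \<beta> + suminf g"
    unfolding Theta_def m_bar_witness g_def a_def b_def ..
  ultimately show ?thesis
    by (simp add: witness_orbit_def Let_def a_def b_def)
qed

text \<open>The hypothesis \<open>\<Theta> = 0\<close> enters only as \<open>y\<^sub>0 = \<beta>\<close>. Once the formal points \<open>z\<close> and
  \<open>b (1 - a z)\<close> are known to be on their prescribed sides, the possible first differences are few,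
  and all of them point in the same direction.\<close>

lemma kneading_less_witness:
  assumes "(\<alpha>, \<beta>) \<in> U" and "Theta witness \<alpha> \<beta> = 0" and "kneading \<alpha> \<beta> \<noteq> witness"
  shows "kneading \<alpha> \<beta> \<prec> witness"
proof -
  define a b where "a = (1 - \<alpha>) / \<beta>" and "b = \<alpha> / \<beta>"
  note ab = inverse_slopes[OF assms(1), folded a_def b_def]
  note U = U_D[OF assms(1)]
  let ?y = "witness_orbit a b"
  define z where "z = RLR_point a b"
  have bo: "backward_orbit \<alpha> \<beta> witness_letter ?y"
    by (rule backward_orbit_witness[of \<alpha> \<beta>, folded a_def b_def, OF less_imp_neq[OF ab(6)]])
  have y0: "?y 0 = \<beta>"
    using assms(2) Theta_witness[OF assms(1)] by (simp add: a_def b_def)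
  have \<alpha>: "\<alpha> = b * \<beta>" and \<alpha>': "\<alpha> = 1 - a * \<beta>"
    using U by (auto simp: a_def b_def)
  have fixed: "z = 1 - a * (b * (1 - a * z))"
    using RLR_point_fixed[of a b] ab(6) by (simp add: z_def)
  \<comment> \<open>Here \<open>b\<^sup>3 z = y\<^sub>1\<close> and \<open>z = y\<^sub>7\<close>, and the inverse branch of \<open>R\<close>, which reverses the order,
    takes these two points to \<open>y\<^sub>0 = \<beta>\<close> and \<open>y\<^sub>6 = 1 - a z\<close>.\<close>
  have "b ^ 3 * z < z"
    using ab power_less_one_iff[of b 3] by (simp add: z_def)
  hence "1 - a * z < 1 - a * (b ^ 3 * z)"
    using ab by simp
  hence y6: "1 - a * z < \<beta>"
    using y0 by (simp add: witness_orbit_def z_def Let_def mult.assoc)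
  have y5: "b * (1 - a * z) < \<alpha>"
    unfolding \<alpha> using y6 ab by simp
  have y4: "\<alpha> < z"
  proof -
    have "a * (b * (1 - a * z)) < a * \<beta>" using y5 U ab by simp
    thus ?thesis using fixed \<alpha>' by linarith
  qed
  have "kneading \<alpha> \<beta> \<noteq> (\<lambda>n. Some (witness_letter n))"
    using assms(3) by (simp add: witness_def[abs_def])
  from first_difference[OF assms(1) bo y0 witness_letter_neq_C this]
  obtain n c where eq: "\<And>i. i < n \<Longrightarrow> kneading \<alpha> \<beta> i = Some (witness_letter i)"
    and c: "kneading \<alpha> \<beta> n = Some c"
    and side: "witness_letter n = L \<and> \<alpha> \<le> ?y n \<and> c \<in> {C, R} \<or> witness_letter n = R \<and> ?y n \<le> \<alpha> \<and> c \<in> {L, C}"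
    and before: "\<And>i. i < n \<Longrightarrow> (if witness_letter i = L then ?y i < \<alpha> else \<alpha> < ?y i)"
    by metis
  have "n \<noteq> 0"
  proof
    assume "n = 0"
    hence "\<beta> \<le> \<alpha>" using side y0 by (simp add: witness_letter_def)
    thus False using U by simp
  qed
  have "n mod 3 = 0" if "n \<ge> 4"
  proof -
    have "n mod 3 \<noteq> 1" using side that y4 by (auto simp: witness_letter_def witness_orbit_def z_def Let_def)
    moreover have "n mod 3 \<noteq> 2" using side that y5 by (auto simp: witness_letter_def witness_orbit_def z_def Let_def)
    ultimately show ?thesis by linarith
  qed
  \<comment> \<open>A later failure would repeat, by periodicity, one that already occurred at index 6.\<close>
  moreover have "\<not> n \<ge> 7"
  proof
    assume "n \<ge> 7"
    hence "n mod 3 = 0" using calculation by simp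
    hence "?y 6 \<le> \<alpha>"
      using side \<open>n \<ge> 7\<close> by (auto simp: witness_letter_def witness_orbit_def)
    thus False using before[of 6] \<open>n \<ge> 7\<close> by (simp add: witness_letter_def)
  qed
  ultimately have n: "n = 1 \<or> n = 2 \<or> n = 3 \<or> n = 6"
    using \<open>n \<noteq> 0\<close> by presburger
  have Rs: "{i. i < n \<and> kneading \<alpha> \<beta> i = Some R} = {i. i < n \<and> witness_letter i = R}"
    using eq by auto
  have "witness_letter i = R \<longleftrightarrow> i = 0 \<or> i = 4" if "i < 6" for i
  proof -
    have "i mod 3 = 2 \<longleftrightarrow> i = 2 \<or> i = 5" using that by presburger
    thus ?thesis using that by (auto simp: witness_letter_def)
  qed
  hence "{i. i < n \<and> witness_letter i = R} = (if n = 6 then {0, 4} else {0})"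
    using n by fastforce
  hence "even (card {i. i < n \<and> kneading \<alpha> \<beta> i = Some R}) \<longleftrightarrow> n = 6"
    using Rs by auto
  hence "if even (card {i. i < n \<and> kneading \<alpha> \<beta> i = Some R})
    then sym_less c (witness_letter n) else sym_less (witness_letter n) c"
    using side n by (auto simp: sym_less_def witness_letter_def)
  moreover have "c \<noteq> witness_letter n" using side by auto
  ultimately show ?thesis
    unfolding itin_less_def using eq c by (intro exI[of _ n]) (simp add: witness_def)
qed

section \<open>Two parameters on the line \<open>\<alpha> = 1/2\<close>\<close>

text \<open>For \<open>\<alpha> = 1/2\<close> and \<open>\<beta> = 1/(2 t)\<close> both reciprocal slopes equal \<open>t\<close>, and clearing the
  denominators in \<open>y\<^sub>0 = \<beta>\<close> leaves \<open>half_poly t = 0\<close>.\<close>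

definition half_poly :: "real \<Rightarrow> real" where
  "half_poly t = 2 * t ^ 6 + 2 * t ^ 5 - 2 * t ^ 3 - t\<^sup>2 - t + 1"

lemma half_poly_roots:
  obtains t\<^sub>1 t\<^sub>2 where "1/2 < t\<^sub>1" "t\<^sub>1 \<le> 3/5" "half_poly t\<^sub>1 = 0" "7/10 \<le> t\<^sub>2" "t\<^sub>2 < 1" "half_poly t\<^sub>2 = 0"
proof -
  have cont: "continuous_on A half_poly" for A
    unfolding half_poly_def[abs_def] by (intro continuous_intros)
  have v: "half_poly (1/2) > 0" "half_poly (3/5) < 0" "half_poly (7/10) < 0" "half_poly 1 > 0"
    by (auto simp: half_poly_def power_numeral_reduce)
  obtain t\<^sub>1 where "1/2 \<le> t\<^sub>1" "t\<^sub>1 \<le> 3/5" "half_poly t\<^sub>1 = 0"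
    using IVT2'[of half_poly "3/5" 0 "1/2"] v cont by auto
  moreover obtain t\<^sub>2 where "7/10 \<le> t\<^sub>2" "t\<^sub>2 \<le> 1" "half_poly t\<^sub>2 = 0"
    using IVT'[of half_poly "7/10" 0 1] v cont by auto
  moreover have "t\<^sub>1 \<noteq> 1/2" using v(1) \<open>half_poly t\<^sub>1 = 0\<close> by force
  moreover have "t\<^sub>2 \<noteq> 1" using v(4) \<open>half_poly t\<^sub>2 = 0\<close> by force
  ultimately show thesis by (intro that[of t\<^sub>1 t\<^sub>2]) auto
qed

lemma RLR_point_diagonal:
  assumes "0 < t" "t < 1"
  shows "RLR_point t t = (1 + t) / (1 + t + t\<^sup>2)"
proof -
  have 1: "1 - t * t = (1 - t) * (1 + t)" "1 - t\<^sup>2 * t = (1 - t) * (1 + t + t\<^sup>2)"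
    by (auto simp: algebra_simps power2_eq_square)
  show ?thesis using assms by (simp add: RLR_point_def 1)
qed

lemma half_poly_root:
  assumes "1/2 < t" "t < 1" "half_poly t = 0"
  defines "\<beta> \<equiv> 1 / (2 * t)"
  shows "(1/2, \<beta>) \<in> U" "(1 - 1/2) / \<beta> = t" "1/2 / \<beta> = t" "witness_orbit t t 0 = \<beta>"
proof -
  show "(1/2, \<beta>) \<in> U" "(1 - 1/2) / \<beta> = t" "1/2 / \<beta> = t"
    using assms by (auto simp: U_def \<beta>_def field_simps)
  have pos: "1 + t + t\<^sup>2 > 0" using assms by (simp add: add_pos_nonneg)
  have "(2 * t - 1) * (1 + t + t\<^sup>2) = 2 * t ^ 5 * (1 + t)"
    using assms(3) by (simp add: half_poly_def algebra_simps power_numeral_reduce)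
  hence "2 * t - 1 = 2 * t ^ 5 * RLR_point t t"
    using pos assms by (simp add: RLR_point_diagonal field_simps)
  moreover have "t ^ 5 = t * (t * t ^ 3)" by (simp add: power_numeral_reduce)
  hence "2 * t * witness_orbit t t 0 = 2 * t - 2 * t ^ 5 * RLR_point t t"
    by (simp add: witness_orbit_def Let_def right_diff_distrib)
  ultimately have "2 * t * witness_orbit t t 0 = 1" by linarith
  thus "witness_orbit t t 0 = \<beta>"
    using assms by (simp add: \<beta>_def field_simps)
qed

text \<open>The condition on \<open>y\<^sub>3\<close> separates the two roots: the threshold, the reciprocal golden ratio
  \<open>0.618\<dots>\<close>, lies between them.\<close>

lemma third_point_less_half_iff:
  assumes "0 < t" "t < 1"
  shows "witness_orbit t t 3 < 1/2 \<longleftrightarrow> t + t\<^sup>2 < 1"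
proof -
  have "1 + t + t\<^sup>2 > 0" using assms by (simp add: add_pos_nonneg)
  thus ?thesis
    using assms by (simp add: witness_orbit_def Let_def RLR_point_diagonal field_simps power2_eq_square)
qed

text \<open>For the smaller root the whole formal orbit is on the prescribed sides. Everything follows from
  \<open>t z < 1/2\<close>, together with \<open>z > 1/2\<close>.\<close>

lemma witness_in_kneading_seqs_inf: "witness \<in> kneading_seqs_inf"
proof -
  obtain t where t: "1/2 < t" "t \<le> 3/5" "half_poly t = 0"
    using half_poly_roots by metis
  define \<beta> where "\<beta> = 1 / (2 * t)"
  have "t < 1" using t by simp
  note h = half_poly_root[OF t(1) this t(3), folded \<beta>_def]
  define z where "z = RLR_point t t"
  have z: "0 < z" "t\<^sup>2 * t < 1"
    using inverse_slopes[OF h(1)] unfolding h by (auto simp: z_def)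
  have "t * t \<le> 3/5 * (3/5)" using t by (intro mult_mono) auto
  hence "t + t\<^sup>2 < 1" using t by (simp add: power2_eq_square)
  hence tz: "t * z < 1/2"
    using third_point_less_half_iff[of t] t by (simp add: witness_orbit_def z_def)
  have y123: "t ^ k * z < 1/2" if "1 \<le> k" for k
  proof -
    have "t ^ k \<le> t ^ 1" using that t by (intro power_decreasing) auto
    hence "t ^ k * z \<le> t ^ 1 * z" using z by (intro mult_right_mono) auto
    thus ?thesis using tz by simp
  qed
  have pos: "1 + t + t\<^sup>2 > 0" using t by (simp add: add_pos_nonneg)
  have y4: "1/2 < z"
    using t pos power2_nonneg_ge_1_iff[of t] mult_strict_mono[of t 1 t 1]
    by (simp add: z_def RLR_point_diagonal field_simps power2_eq_square)
  have y5: "t * (1 - t * z) < 1/2"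
  proof -
    have "1 - t * z < 1 - t * (1/2)" using y4 t by simp
    hence "t * (1 - t * z) < t * (1 - t * (1/2))" using t by simp
    also have "\<dots> \<le> 1/2" using zero_le_power2[of "1 - t"]
      by (simp add: power2_eq_square algebra_simps)
    finally show ?thesis .
  qed
  have "kneading (1/2) \<beta> = (\<lambda>n. Some (witness_letter n))"
  proof (rule kneading_eqI[OF h(1), where y = "witness_orbit t t", OF _ h(4) witness_letter_neq_C])
    show "backward_orbit (1/2) \<beta> witness_letter (witness_orbit t t)"
      using backward_orbit_witness[of "1/2" \<beta>] z(2) unfolding h by simp
    show "if witness_letter n = L then witness_orbit t t n < 1/2 else 1/2 < witness_orbit t t n" for n
      using h(4) U_D[OF h(1)] y123[of "4 - n"] y4 y5 tz
      by (auto simp: witness_letter_def witness_orbit_def Let_def z_def)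
  qed
  hence "witness = kneading (1/2) \<beta>" by (simp add: witness_def[abs_def])
  moreover have "1/2 < \<beta> \<and> \<beta> \<le> 1" using h(1) by (auto simp: U_def)
  ultimately have "witness \<in> kneading_seqs" unfolding kneading_seqs_def by blast
  thus ?thesis by (simp add: kneading_seqs_inf_def witness_def witness_letter_neq_C)
qed

lemma Theta_witness_spurious_zero: "\<exists>(\<alpha>, \<beta>) \<in> U. Theta witness \<alpha> \<beta> = 0 \<and> kneading \<alpha> \<beta> \<noteq> witness"
proof -
  obtain t where t: "7/10 \<le> t" "t < 1" "half_poly t = 0"
    using half_poly_roots by metis
  define \<beta> where "\<beta> = 1 / (2 * t)"
  have "1/2 < t" using t by simp
  note h = half_poly_root[OF this t(2,3), folded \<beta>_def]
  have "t\<^sup>2 * t < 1"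
    using inverse_slopes[OF h(1)] unfolding h by simp
  hence bo: "backward_orbit (1/2) \<beta> witness_letter (witness_orbit t t)"
    using backward_orbit_witness[of "1/2" \<beta>] unfolding h by simp
  have "7/10 * (7/10) \<le> t * t" using t by (intro mult_mono) auto
  hence "\<not> witness_orbit t t 3 < 1/2"
    using third_point_less_half_iff[of t] t by (simp add: power2_eq_square)
  moreover have "witness_letter 3 = L" by (simp add: witness_letter_def)
  ultimately have "kneading (1/2) \<beta> \<noteq> witness"
    using kneading_eqD[OF h(1) bo h(4) witness_letter_neq_C, of 3] by (auto simp: witness_def[abs_def])
  moreover have "Theta witness (1/2) \<beta> = 0"
    using Theta_witness[OF h(1)] unfolding h by simp
  ultimately show ?thesis using h(1) by blast
qed

theorem theorem7:
  "\<exists>M \<in> kneading_seqs_inf - {RL_inf}.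
     (\<exists>(\<alpha>, \<beta>) \<in> U. Theta M \<alpha> \<beta> = 0 \<and> kneading \<alpha> \<beta> \<noteq> M) \<and>
     (\<forall>(\<alpha>, \<beta>) \<in> U. Theta M \<alpha> \<beta> = 0 \<and> kneading \<alpha> \<beta> \<noteq> M \<longrightarrow> kneading \<alpha> \<beta> \<prec> M)"
proof (intro bexI[of _ witness] conjI)
  have "witness 4 \<noteq> RL_inf 4" by (simp add: witness_def RL_inf_def witness_letter_def)
  thus "witness \<in> kneading_seqs_inf - {RL_inf}" using witness_in_kneading_seqs_inf by auto
qed (use Theta_witness_spurious_zero kneading_less_witness in auto)

end
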